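(* Let $g_1,\dots,g_m\in\mathbb{R}[\mathbf{x}]=\mathbb{R}[x_1,\dots,x_n]$ and let $\mathbf{K}:=\{\mathbf{x}\in\mathbb{R}^n : g_j(\mathbf{x})\ge 0,\ j=1,\dots,m\}$ be compact. Let $p_i,q_i\in\mathbb{R}[\mathbf{x}]$, $i=1,\dots,N$, with $q_i>0$ on $\mathbf{K}$ for every $i=1,\dots,N$. Let $$f^*:=\inf_{\mathbf{x}\in\mathbf{K}}\ \sum_{i=1}^N\frac{p_i(\mathbf{x})}{q_i(\mathbf{x})}$$ and let $\hat f$ be the optimal value of the infinite-dimensional linear problem $$\hat f:=\inf_{\mu_1,\dots,\mu_N\in\mathcal{M}(\mathbf{K})}\ \sum_{i=1}^N\int_{\mathbf{K}}p_i\,d\mu_i$$ subject to $$\int_{\mathbf{K}}q_1\,d\mu_1=1,\qquad \int_{\mathbf{K}}\mathbf{x}^{\alpha}q_i\,d\mu_i=\int_{\mathbf{K}}\mathbf{x}^{\alpha}q_1\,d\mu_1\quad\forall\alpha\in\mathbb{N}^n,\ i=2,\dots,N.$$ Then $\hat f=f^*$.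
   Context: $\mathcal{M}(\mathbf{K})$ denotes the space of finite (nonnegative) Borel measures supported on $\mathbf{K}$. $\mathbb{N}$ contains $0$, and $\mathbf{x}^\alpha=x_1^{\alpha_1}\cdots x_n^{\alpha_n}$. *)

theory Defs
  imports "HOL-Analysis.Analysis" "HOL-Library.Poly_Mapping"
begin

text \<open>
  Elements of the polynomial ring \<open>\<real>[x\<^sub>1,\<dots>,x\<^sub>n]\<close>, with \<open>n = CARD('n)\<close>, are finitely supported maps
  from exponents \<open>\<alpha> \<in> \<nat>\<^sup>n\<close> (type \<open>'n \<Rightarrow>\<^sub>0 nat\<close>, which is all of \<open>\<nat>\<^sup>n\<close> because \<open>'n\<close> is finite)
  to coefficients.
\<close>

type_synonym 'n exponent = "'n \<Rightarrow>\<^sub>0 nat"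
type_synonym 'n real_mpoly = "'n exponent \<Rightarrow>\<^sub>0 real"

definition monomial_at :: "'n::finite exponent \<Rightarrow> real ^ 'n \<Rightarrow> real" where
  "monomial_at \<alpha> x = (\<Prod>i\<in>UNIV. (x $ i) ^ Poly_Mapping.lookup \<alpha> i)"

definition poly_at :: "'n::finite real_mpoly \<Rightarrow> real ^ 'n \<Rightarrow> real" where
  "poly_at p x = (\<Sum>\<alpha>\<in>Poly_Mapping.keys p. Poly_Mapping.lookup p \<alpha> * monomial_at \<alpha> x)"

definition semialgebraic_set :: "nat \<Rightarrow> (nat \<Rightarrow> 'n::finite real_mpoly) \<Rightarrow> (real ^ 'n) set" where
  "semialgebraic_set m g = {x. \<forall>j\<in>{1..m}. poly_at (g j) x \<ge> 0}"

text \<open>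
  Measures are taken on the whole space; for closed \<open>K\<close>, having support contained in \<open>K\<close> means that
  the complement of \<open>K\<close> is a null set.
\<close>

definition borel_measures_on :: "'a::topological_space set \<Rightarrow> 'a measure set" where
  "borel_measures_on K =
     {\<mu>. sets \<mu> = sets borel \<and> finite_measure \<mu> \<and> emeasure \<mu> (- K) = 0}"

definition lp_feasible ::
  "nat \<Rightarrow> (nat \<Rightarrow> 'n::finite real_mpoly) \<Rightarrow> (real ^ 'n) set \<Rightarrow> (nat \<Rightarrow> (real ^ 'n) measure) set"
where
  "lp_feasible N q K =
     {\<mu>. (\<forall>i\<in>{1..N}. \<mu> i \<in> borel_measures_on K) \<and>
         (LINT x:K|\<mu> 1. poly_at (q 1) x) = 1 \<and>
         (\<forall>i\<in>{2..N}. \<forall>\<alpha>.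
            (LINT x:K|\<mu> i. monomial_at \<alpha> x * poly_at (q i) x) =
            (LINT x:K|\<mu> 1. monomial_at \<alpha> x * poly_at (q 1) x))}"

text \<open>
  Both optimal values are extended reals, so that the infimum over an empty set is \<open>\<infinity>\<close>.
\<close>

definition lp_value ::
  "nat \<Rightarrow> (nat \<Rightarrow> 'n::finite real_mpoly) \<Rightarrow> (nat \<Rightarrow> 'n real_mpoly) \<Rightarrow> (real ^ 'n) set \<Rightarrow> ereal"
where
  "lp_value N p q K =
     (INF \<mu>\<in>lp_feasible N q K. ereal (\<Sum>i=1..N. LINT x:K|\<mu> i. poly_at (p i) x))"

definition rational_sum_inf ::
  "nat \<Rightarrow> (nat \<Rightarrow> 'n::finite real_mpoly) \<Rightarrow> (nat \<Rightarrow> 'n real_mpoly) \<Rightarrow> (real ^ 'n) set \<Rightarrow> ereal"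
where
  "rational_sum_inf N p q K =
     (INF x\<in>K. ereal (\<Sum>i=1..N. poly_at (p i) x / poly_at (q i) x))"

end

theory Submission
  imports Defs "HOL-Probability.Giry_Monad"
begin

text \<open>
  The substitution \<open>d\<nu>\<^sub>i = q\<^sub>i d\<mu>\<^sub>i\<close> turns the objective into \<open>\<Sum>\<^sub>i \<integral> p\<^sub>i/q\<^sub>i d\<nu>\<^sub>i\<close> and the
  constraints into: \<open>\<nu>\<^sub>1\<close> is a probability measure and all \<open>\<nu>\<^sub>i\<close> have the same moments. On a
  compact set the moments determine the integral of every continuous function, by the
  Stone--Weierstrass theorem (\<open>set_integral_eq_of_moments_eq\<close>), and \<open>p\<^sub>i/q\<^sub>i\<close> is continuous because
  \<open>q\<^sub>i > 0\<close>. The objective at a feasible point is thus \<open>\<integral> (\<Sum>\<^sub>i p\<^sub>i/q\<^sub>i) d\<nu>\<^sub>1\<close>, the average of the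
  rational function over a probability measure on \<open>K\<close>, and so at least its minimum over \<open>K\<close>
  (\<open>lp_objective_ge\<close>). Conversely the value at any \<open>x \<in> K\<close> is attained by \<open>\<nu>\<^sub>i = \<delta>\<^sub>x\<close>, that is, by
  the point masses \<open>\<mu>\<^sub>i = \<delta>\<^sub>x / q\<^sub>i(x)\<close> (\<open>point_masses_feasible\<close>). If \<open>K\<close> is empty, neither problem
  has a feasible point, and both values are \<open>\<infinity>\<close>.
\<close>

section \<open>Polynomials as continuous functions\<close>

lemma continuous_on_monomial_at [continuous_intros]: "continuous_on S (monomial_at \<alpha>)"
  unfolding monomial_at_def by (intro continuous_intros)

lemma continuous_on_poly_at [continuous_intros]: "continuous_on S (poly_at p)"
  unfolding poly_at_def by (intro continuous_intros)

lemma monomial_at_zero [simp]: "monomial_at 0 x = 1"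
  by (simp add: monomial_at_def)

lemma monomial_at_add: "monomial_at (\<alpha> + \<beta>) x = monomial_at \<alpha> x * monomial_at \<beta> x"
  by (simp add: monomial_at_def lookup_add power_add prod.distrib)

lemma monomial_at_single: "monomial_at (Poly_Mapping.single i 1) x = x $ i"
proof -
  have "monomial_at (Poly_Mapping.single i 1) x = (\<Prod>j\<in>UNIV. if j = i then x $ j else 1)"
    unfolding monomial_at_def by (intro prod.cong) (auto simp: lookup_single when_def)
  then show ?thesis
    by simp
qed

section \<open>Moments determine integrals of continuous functions\<close>

text \<open>
  The polynomials are dense in \<open>C(K)\<close> and \<open>L\<close> is bounded in the supremum norm, so it is enough that \<open>L\<close> vanishes on them. Vanishing is not
  preserved by products, which blocks a direct induction on the formation of a polynomial \<open>f\<close>.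
  The property that is preserved is that multiplication by \<open>f\<close> maps \<open>Z\<close> into \<open>Z\<close>, where \<open>Z\<close> is
  the set of those \<open>h\<close> all of whose products with monomials are annihilated by \<open>L\<close>; the polynomial
  itself is then \<open>f * 1\<close>.
\<close>

lemma functional_vanishing_on_monomials_eq_0:
  fixes K :: "(real ^ 'n::finite) set" and L :: "(real ^ 'n \<Rightarrow> real) \<Rightarrow> real"
  assumes K: "compact K"
    and add: "\<And>f h. continuous_on K f \<Longrightarrow> continuous_on K h \<Longrightarrow> L (\<lambda>x. f x + h x) = L f + L h"
    and scale: "\<And>c f. continuous_on K f \<Longrightarrow> L (\<lambda>x. c * f x) = c * L f"
    and bound: "\<And>f e. continuous_on K f \<Longrightarrow> (\<And>x. x \<in> K \<Longrightarrow> \<bar>f x\<bar> \<le> e) \<Longrightarrow> \<bar>L f\<bar> \<le> C * e"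
    and monomials: "\<And>\<alpha>. L (monomial_at \<alpha>) = 0"
    and f: "continuous_on K f"
  shows "L f = 0"
proof -
  have zero: "L (\<lambda>x. 0) = 0"
    using scale[of "\<lambda>x. 0" 0] by simp
  have sum: "L (\<lambda>x. \<Sum>i\<in>I. F i x) = (\<Sum>i\<in>I. L (F i))"
    if "finite I" "\<And>i. i \<in> I \<Longrightarrow> continuous_on K (F i)" for I :: "'n set" and F
    using that by (induction I rule: finite_induct) (auto simp: zero add continuous_on_sum)
  define Z where
    "Z = {h. continuous_on K h \<and> (\<forall>\<alpha>. L (\<lambda>x. h x * monomial_at \<alpha> x) = 0)}"
  have Z_coordinate: "L (\<lambda>x. (x $ i * h x) * monomial_at \<alpha> x) = 0" if "h \<in> Z" for h i \<alpha>
  proof -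
    have "(\<lambda>x. (x $ i * h x) * monomial_at \<alpha> x)
        = (\<lambda>x. h x * monomial_at (Poly_Mapping.single i 1 + \<alpha>) x)"
      by (auto simp: monomial_at_add monomial_at_single[unfolded One_nat_def] ac_simps)
    with that show ?thesis
      by (simp add: Z_def)
  qed
  have Z_mult: "(\<lambda>x. f x * h x) \<in> Z" if "real_polynomial_function f" "h \<in> Z" for f h
    using that
  proof (induction arbitrary: h rule: real_polynomial_function.induct)
    case (linear f)
    then have h: "continuous_on K h" and f: "linear f"
      by (auto simp: Z_def bounded_linear.linear)
    have f_eq: "f x = (\<Sum>i\<in>UNIV. f (axis i 1) * x $ i)" for x
    proof -
      have "f x = f (\<Sum>i\<in>UNIV. x $ i *\<^sub>R axis i 1)"
        using basis_expansion[of x] by (simp add: scalar_mult_eq_scaleR)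
      also have "\<dots> = (\<Sum>i\<in>UNIV. f (axis i 1) * x $ i)"
        using f by (simp add: linear_sum linear_scale mult.commute)
      finally show ?thesis .
    qed
    have "L (\<lambda>x. f x * h x * monomial_at \<alpha> x) = 0" for \<alpha>
    proof -
      have "L (\<lambda>x. f x * h x * monomial_at \<alpha> x)
          = L (\<lambda>x. \<Sum>i\<in>UNIV. f (axis i 1) * ((x $ i * h x) * monomial_at \<alpha> x))"
        by (subst f_eq) (simp add: sum_distrib_right mult.assoc)
      also have "\<dots> = (\<Sum>i\<in>UNIV. f (axis i 1) * L (\<lambda>x. (x $ i * h x) * monomial_at \<alpha> x))"
        using h by (subst sum) (auto intro!: continuous_intros sum.cong scale)
      finally show ?thesis
        using linear by (simp add: Z_coordinate)
    qed
    with h linear_continuous_on[OF linear(1)] show ?case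
      by (auto simp: Z_def intro: continuous_on_mult)
  next
    case (const c)
    then have "L (\<lambda>x. c * (h x * monomial_at \<alpha> x)) = 0" for \<alpha>
      by (subst scale) (auto simp: Z_def intro!: continuous_intros)
    with const show ?case
      by (auto simp: Z_def mult.assoc intro!: continuous_intros)
  next
    case (add f g)
    then have fg: "(\<lambda>x. f x * h x) \<in> Z" "(\<lambda>x. g x * h x) \<in> Z"
      by auto
    then have "L (\<lambda>x. f x * h x * monomial_at \<alpha> x + g x * h x * monomial_at \<alpha> x) = 0" for \<alpha>
      by (subst assms(2)) (auto simp: Z_def intro!: continuous_on_mult continuous_on_monomial_at)
    with fg show ?case
      by (auto simp: Z_def distrib_right intro: continuous_on_add)
  next
    case (mult f g)
    then have "(\<lambda>x. f x * (g x * h x)) \<in> Z"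
      by blast
    then show ?case
      by (simp add: mult.assoc)
  qed
  have one: "(\<lambda>x. 1) \<in> Z"
    by (simp add: Z_def monomials)
  have polynomials: "L f = 0" if "real_polynomial_function f" for f
    using Z_mult[OF that one] monomial_at_zero
    by (auto simp: Z_def dest!: spec[of _ 0])
  have "\<bar>L f\<bar> \<le> C * e" if e: "e > 0" for e
  proof -
    obtain h where h: "real_polynomial_function h" "\<And>x. x \<in> K \<Longrightarrow> \<bar>f x - h x\<bar> < e"
      using Stone_Weierstrass_real_polynomial_function[OF K f e] by blast
    have h_cont: "continuous_on K h"
      using h(1) continuous_on_polymonial_function real_polynomial_function_eq by blast
    have "L f = L (\<lambda>x. h x + (f x - h x))"
      by simp
    also have "\<dots> = L (\<lambda>x. f x - h x)"
      using add[of h "\<lambda>x. f x - h x"] h_cont f polynomials[OF h(1)] by (simp add: continuous_on_diff)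
    also have "\<bar>\<dots>\<bar> \<le> C * e"
      using h_cont f h(2) by (intro bound continuous_intros) (auto intro: less_imp_le)
    finally show ?thesis .
  qed
  moreover have "((\<lambda>e. C * e) \<longlongrightarrow> C * 0) (at_right 0)"
    by (intro tendsto_intros)
  ultimately have "\<bar>L f\<bar> \<le> C * 0"
    by (intro tendsto_lowerbound[of "\<lambda>e. C * e" _ "at_right 0"])
      (auto simp: eventually_at_right_less intro: eventually_at_rightI[of 0 1])
  then show ?thesis
    by simp
qed

lemma set_integrable_continuous_on_compact:
  fixes f :: "'a::{t2_space} \<Rightarrow> real"
  assumes \<mu>: "\<mu> \<in> borel_measures_on K" and K: "compact K" and f: "continuous_on K f"
  shows "set_integrable \<mu> K f"
proof -
  interpret finite_measure \<mu>
    using \<mu> by (simp add: borel_measures_on_def)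
  obtain B where B: "\<And>x. x \<in> K \<Longrightarrow> \<bar>f x\<bar> \<le> B"
    using compact_imp_bounded[OF compact_continuous_image[OF f K]] by (auto simp: bounded_iff)
  have "(\<lambda>x. indicator K x *\<^sub>R f x) \<in> borel_measurable borel"
    using K f by (intro borel_measurable_continuous_on_indicator) (auto simp: compact_imp_closed)
  then have "(\<lambda>x. indicator K x *\<^sub>R f x) \<in> borel_measurable \<mu>"
    using \<mu> measurable_cong_sets[of \<mu> borel borel borel] by (auto simp: borel_measures_on_def)
  then show ?thesis
    unfolding set_integrable_def
    by (rule integrable_const_bound[where B = "\<bar>B\<bar>", rotated])
      (auto simp: indicator_def intro!: AE_I2 order.trans[OF B])
qed

lemma abs_set_integral_mult_le:
  fixes f u :: "'a::{t2_space} \<Rightarrow> real"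
  assumes \<mu>: "\<mu> \<in> borel_measures_on K" and K: "compact K"
    and f: "continuous_on K f" and u: "continuous_on K u"
    and le: "\<And>x. x \<in> K \<Longrightarrow> \<bar>f x\<bar> \<le> e"
  shows "\<bar>LINT x:K|\<mu>. f x * u x\<bar> \<le> (LINT x:K|\<mu>. \<bar>u x\<bar>) * e"
proof -
  have "\<bar>LINT x:K|\<mu>. f x * u x\<bar> \<le> (LINT x:K|\<mu>. \<bar>f x * u x\<bar>)"
    using set_integral_norm_bound[OF set_integrable_continuous_on_compact[OF \<mu> K],
        of "\<lambda>x. f x * u x"] f u
    by (simp add: continuous_on_mult)
  also have "\<dots> \<le> (LINT x:K|\<mu>. \<bar>u x\<bar> * e)"
    using f u le
    by (intro set_integral_mono set_integrable_continuous_on_compact[OF \<mu> K] continuous_intros)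
      (auto simp: abs_mult mult.commute intro: mult_right_mono)
  finally show ?thesis
    by simp
qed

text \<open>
  The difference of the two sides is a functional of \<open>f\<close> that vanishes on monomials. Carrying the
  weights \<open>u\<close> and \<open>v\<close> along makes the lemma apply to \<open>q\<^sub>i d\<mu>\<^sub>i\<close> without forming that measure; the
  bounding constant is the sum of the total variations of the two weighted measures.
\<close>

lemma set_integral_eq_of_moments_eq:
  fixes K :: "(real ^ 'n::finite) set" and u v f :: "real ^ 'n \<Rightarrow> real"
  assumes K: "compact K" and \<mu>: "\<mu> \<in> borel_measures_on K" and \<nu>: "\<nu> \<in> borel_measures_on K"
    and u: "continuous_on K u" and v: "continuous_on K v"
    and moments: "\<And>\<alpha>. (LINT x:K|\<mu>. monomial_at \<alpha> x * u x) = (LINT x:K|\<nu>. monomial_at \<alpha> x * v x)"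
    and f: "continuous_on K f"
  shows "(LINT x:K|\<mu>. f x * u x) = (LINT x:K|\<nu>. f x * v x)"
proof -
  define L where "L f = (LINT x:K|\<mu>. f x * u x) - (LINT x:K|\<nu>. f x * v x)" for f
  note int = set_integrable_continuous_on_compact[OF _ K] continuous_on_mult
  have "L f = 0"
  proof (rule functional_vanishing_on_monomials_eq_0[OF K _ _ _ _ f])
    show "L (\<lambda>x. f x + h x) = L f + L h" if "continuous_on K f" "continuous_on K h" for f h
      using that \<mu> \<nu> u v by (simp add: L_def distrib_right set_integral_add(2) int)
    show "L (\<lambda>x. c * f x) = c * L f" for c f
      by (simp add: L_def mult.assoc right_diff_distrib)
    show "\<bar>L f\<bar> \<le> ((LINT x:K|\<mu>. \<bar>u x\<bar>) + (LINT x:K|\<nu>. \<bar>v x\<bar>)) * e"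
      if "continuous_on K f" "\<And>x. x \<in> K \<Longrightarrow> \<bar>f x\<bar> \<le> e" for f e
      using abs_set_integral_mult_le[OF \<mu> K that(1) u that(2)]
        abs_set_integral_mult_le[OF \<nu> K that(1) v that(2)]
      by (simp add: L_def distrib_right)
    show "L (monomial_at \<alpha>) = 0" for \<alpha>
      by (simp add: L_def moments)
  qed
  then show ?thesis
    by (simp add: L_def)
qed

section \<open>Lower bound for the linear problem\<close>

text \<open>
  Writing \<open>p\<^sub>i = (p\<^sub>i/q\<^sub>i) q\<^sub>i\<close> lets the equality of moments replace each \<open>q\<^sub>i d\<mu>\<^sub>i\<close> by the single
  probability measure \<open>q\<^sub>1 d\<mu>\<^sub>1\<close>, and an average is at least any lower bound of the integrand.
\<close>

lemma lp_objective_ge: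
  fixes K :: "(real ^ 'n::finite) set" and p q :: "nat \<Rightarrow> 'n real_mpoly"
  assumes N: "N \<ge> 1" and K: "compact K"
    and q: "\<And>i x. i \<in> {1..N} \<Longrightarrow> x \<in> K \<Longrightarrow> poly_at (q i) x > 0"
    and \<mu>: "\<mu> \<in> lp_feasible N q K"
    and c: "\<And>x. x \<in> K \<Longrightarrow> c \<le> (\<Sum>i=1..N. poly_at (p i) x / poly_at (q i) x)"
  shows "c \<le> (\<Sum>i=1..N. LINT x:K|\<mu> i. poly_at (p i) x)"
proof -
  define r where "r i x = poly_at (p i) x / poly_at (q i) x" for i x
  have meas: "\<mu> i \<in> borel_measures_on K" if "i \<in> {1..N}" for i
    using \<mu> that by (auto simp: lp_feasible_def)
  have r: "continuous_on K (r i)" if "i \<in> {1..N}" for i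
    unfolding r_def using q[OF that] by (intro continuous_intros) force
  have K_sets: "K \<in> sets (\<mu> i)" if "i \<in> {1..N}" for i
    using meas[OF that] K by (auto simp: borel_measures_on_def compact_imp_closed)
  note int = set_integrable_continuous_on_compact[OF meas K]
  have one: "1 \<in> {1..N}"
    using N by simp
  have moments: "(LINT x:K|\<mu> i. monomial_at \<alpha> x * poly_at (q i) x)
      = (LINT x:K|\<mu> 1. monomial_at \<alpha> x * poly_at (q 1) x)" if "i \<in> {1..N}" for i \<alpha>
    using \<mu> that by (cases "i = 1") (auto simp: lp_feasible_def)
  have substitute: "(LINT x:K|\<mu> i. poly_at (p i) x) = (LINT x:K|\<mu> 1. r i x * poly_at (q 1) x)"
    if i: "i \<in> {1..N}" for i
  proof -
    have "(LINT x:K|\<mu> i. poly_at (p i) x) = (LINT x:K|\<mu> i. r i x * poly_at (q i) x)"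
      using q[OF i] K_sets[OF i] by (intro set_lebesgue_integral_cong) (force simp: r_def)+
    also have "\<dots> = (LINT x:K|\<mu> 1. r i x * poly_at (q 1) x)"
      by (rule set_integral_eq_of_moments_eq[OF K meas[OF i] meas[OF one] _ _ moments[OF i] r[OF i]])
        (intro continuous_intros)+
    finally show ?thesis .
  qed
  have "c = c * (LINT x:K|\<mu> 1. poly_at (q 1) x)"
    using \<mu> by (simp add: lp_feasible_def)
  also have "\<dots> = (LINT x:K|\<mu> 1. c * poly_at (q 1) x)"
    by simp
  also have "\<dots> \<le> (LINT x:K|\<mu> 1. (\<Sum>i=1..N. r i x) * poly_at (q 1) x)"
    using c q[OF one] r
    by (intro set_integral_mono int[OF one] continuous_intros)
      (auto simp: r_def intro!: mult_right_mono less_imp_le)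
  also have "\<dots> = (\<Sum>i=1..N. LINT x:K|\<mu> 1. r i x * poly_at (q 1) x)"
  proof -
    have "integrable (\<mu> 1) (\<lambda>x. indicator K x *\<^sub>R (r i x * poly_at (q 1) x))" if "i \<in> {1..N}" for i
      using int[OF one continuous_on_mult[OF r[OF that] continuous_on_poly_at]]
      by (simp add: set_integrable_def)
    then show ?thesis
      unfolding set_lebesgue_integral_def sum_distrib_right scaleR_sum_right
      by (rule Bochner_Integration.integral_sum)
  qed
  finally show ?thesis
    using substitute by simp
qed

section \<open>Point masses\<close>

definition point_mass :: "real \<Rightarrow> 'a::topological_space \<Rightarrow> 'a measure" where
  "point_mass c x = density (return borel x) (\<lambda>_. ennreal c)"

lemma point_mass_in_borel_measures_on:
  assumes "closed K" "x \<in> K"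
  shows "point_mass c x \<in> borel_measures_on K"
  using assms
  by (auto simp: borel_measures_on_def point_mass_def emeasure_density_const ennreal_mult_eq_top_iff
      intro!: finite_measureI)

lemma set_integral_point_mass:
  fixes f :: "'a::topological_space \<Rightarrow> real"
  assumes K: "closed K" and x: "x \<in> K" and c: "c \<ge> 0" and f: "continuous_on K f"
  shows "(LINT y:K|point_mass c x. f y) = c * f x"
proof -
  have meas: "(\<lambda>y. indicator K y *\<^sub>R f y) \<in> borel_measurable borel"
    using K f by (intro borel_measurable_continuous_on_indicator) auto
  have "(LINT y:K|point_mass c x. f y) = (LINT y|return borel x. c *\<^sub>R (indicator K y *\<^sub>R f y))"
    unfolding set_lebesgue_integral_def point_mass_def using c meas by (intro integral_density) auto
  also have "\<dots> = c *\<^sub>R (indicator K x *\<^sub>R f x)"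
    using meas by (intro integral_return) auto
  finally show ?thesis
    using x by simp
qed

lemma point_masses_feasible:
  assumes N: "N \<ge> 1" and K: "closed K" and x: "x \<in> K"
    and q: "\<And>i. i \<in> {1..N} \<Longrightarrow> poly_at (q i) x > 0"
  shows "(\<lambda>i. point_mass (1 / poly_at (q i) x) x) \<in> lp_feasible N q K"
proof -
  have "(LINT y:K|point_mass (1 / poly_at (q i) x) x. monomial_at \<alpha> y * poly_at (q i) y)
      = monomial_at \<alpha> x" if "i \<in> {1..N}" for i \<alpha>
    using q[OF that]
    by (subst set_integral_point_mass[OF K x]) (auto intro!: continuous_intros)
  note moments = this this[where \<alpha> = 0, simplified]
  show ?thesis
    using N by (auto simp: lp_feasible_def moments point_mass_in_borel_measures_on[OF K x])
qed

section \<open>Equality of the two optimal values\<close>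

theorem theorem2p1:
  fixes g p q :: "nat \<Rightarrow> 'n::finite real_mpoly"
    and m N :: nat
    and K :: "(real ^ 'n) set"
  assumes "N \<ge> 1"
    and "K = semialgebraic_set m g"
    and "compact K"
    and "\<And>i x. i \<in> {1..N} \<Longrightarrow> x \<in> K \<Longrightarrow> poly_at (q i) x > 0"
  shows "lp_value N p q K = rational_sum_inf N p q K"
proof (rule antisym)
  note N = assms(1) and K = assms(3) and q = assms(4)
  show "lp_value N p q K \<le> rational_sum_inf N p q K"
    unfolding lp_value_def rational_sum_inf_def
  proof (rule INF_mono)
    fix x assume x: "x \<in> K"
    let ?\<mu> = "\<lambda>i. point_mass (1 / poly_at (q i) x) x"
    have "?\<mu> \<in> lp_feasible N q K"
      using N K q x by (intro point_masses_feasible) (auto simp: compact_imp_closed)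
    moreover have "(LINT y:K|?\<mu> i. poly_at (p i) y) = poly_at (p i) x / poly_at (q i) x"
      if "i \<in> {1..N}" for i
      using K q[OF that x] x
      by (subst set_integral_point_mass) (auto simp: compact_imp_closed intro!: continuous_intros)
    ultimately show "\<exists>\<mu>\<in>lp_feasible N q K. ereal (\<Sum>i=1..N. LINT y:K|\<mu> i. poly_at (p i) y)
        \<le> ereal (\<Sum>i=1..N. poly_at (p i) x / poly_at (q i) x)"
      by (intro bexI[of _ ?\<mu>]) auto
  qed
  show "rational_sum_inf N p q K \<le> lp_value N p q K"
    unfolding lp_value_def
  proof (rule INF_greatest)
    fix \<mu> assume \<mu>: "\<mu> \<in> lp_feasible N q K"
    let ?F = "\<lambda>x. \<Sum>i=1..N. poly_at (p i) x / poly_at (q i) x"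
    \<comment> \<open>Over the empty set the normalization would read \<open>0 = 1\<close>.\<close>
    have "K \<noteq> {}"
      using \<mu> by (auto simp: lp_feasible_def set_lebesgue_integral_def)
    moreover have "continuous_on K ?F"
      using q by (intro continuous_intros) force
    ultimately obtain x where x: "x \<in> K" "\<And>y. y \<in> K \<Longrightarrow> ?F x \<le> ?F y"
      using continuous_attains_inf[OF K] by blast
    have "rational_sum_inf N p q K \<le> ereal (?F x)"
      unfolding rational_sum_inf_def using x(1) by (rule INF_lower)
    also have "\<dots> \<le> ereal (\<Sum>i=1..N. LINT x:K|\<mu> i. poly_at (p i) x)"
      using lp_objective_ge[OF N K q \<mu> x(2)] by simp
    finally show "rational_sum_inf N p q K \<le> ereal (\<Sum>i=1..N. LINT x:K|\<mu> i. poly_at (p i) x)" .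
  qed
qed

end
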